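(* Let $a,c\in\mathbb{R}$ with $a\neq0$, $c\neq 0$, let $p\ge 0$ be an integer, set $d=a(p+4)$, and consider the planar system $$\dot x = y,\qquad \dot y = \frac{d}{2}y-\frac{3}{2}a^{2}x-cx^{2}.$$ In the chart $U_2$ of its Poincaré compactification the system is $$\dot u = v-\frac{duv}{2}+\frac{3}{2}a^{2}u^{2}v+cu^{3},\qquad \dot v = -\frac{dv^{2}}{2}+\frac{3}{2}a^{2}uv^{2}+cu^{2}v,$$ and the critical point $(u,v)=(0,0)$ of this system is a node, stable if $c<0$ and unstable if $c>0$.
   Context: For a polynomial vector field $\dot x=P(x,y)$, $\dot y=Q(x,y)$ of degree $n$, its expression in the chart $U_2$ of the Poincaré compactification (coordinates $u=x/y$, $v=1/y$, with the points at infinity given by $v=0$) is $\dot u=v^{n}\left[P\left(\frac uv,\frac1v\right)-uQ\left(\frac uv,\frac1v\right)\right]$, $\dot v=-v^{n+1}Q\left(\frac uv,\frac1v\right)$. A (possibly non-hyperbolic) isolated critical point is a stable (attracting) node if every orbit starting sufficiently close to it tends to it as $t\to+\infty$ with a definite limiting tangent direction; it is an unstable (repelling) node if the same holds as $t\to-\infty$. *)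

theory Defs
  imports "HOL-Analysis.Analysis"
begin

definition bivariate_poly_le :: "nat \<Rightarrow> (real \<Rightarrow> real \<Rightarrow> real) \<Rightarrow> bool" where
  "bivariate_poly_le n P \<longleftrightarrow>
     (\<exists>k. \<forall>x y. P x y = (\<Sum>i\<le>n. \<Sum>j\<le>n - i. k i j * x ^ i * y ^ j))"

definition polynomial_field ::
  "nat \<Rightarrow> (real \<Rightarrow> real \<Rightarrow> real) \<Rightarrow> (real \<Rightarrow> real \<Rightarrow> real) \<Rightarrow> bool" where
  "polynomial_field n P Q \<longleftrightarrow>
     bivariate_poly_le n P \<and> bivariate_poly_le n Q \<and>
     (\<forall>m<n. \<not> (bivariate_poly_le m P \<and> bivariate_poly_le m Q))"

text \<open>
  The chart formula with \<open>x = u / v\<close> and \<open>y = 1 / v\<close> has removable singularities on the line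
  at infinity \<open>v = 0\<close>. The field there is its continuous extension, which is unique
  (see \<open>chart_U2_field_unique\<close>).
\<close>

definition chart_U2_field ::
  "(real \<Rightarrow> real \<Rightarrow> real) \<Rightarrow> (real \<Rightarrow> real \<Rightarrow> real) \<Rightarrow> (real \<times> real \<Rightarrow> real \<times> real) \<Rightarrow> bool" where
  "chart_U2_field P Q F \<longleftrightarrow>
     (\<exists>n. polynomial_field n P Q \<and>
        continuous_on UNIV F \<and>
        (\<forall>u v. v \<noteq> 0 \<longrightarrow>
           F (u, v) = (v ^ n * (P (u / v) (1 / v) - u * Q (u / v) (1 / v)),
                       - (v ^ (n + 1)) * Q (u / v) (1 / v))))"

lemma polynomial_field_degree_unique:
  assumes "polynomial_field m P Q" "polynomial_field n P Q"
  shows "m = n"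
  using assms unfolding polynomial_field_def by (metis linorder_neqE_nat)

lemma chart_U2_field_unique:
  assumes "chart_U2_field P Q F" "chart_U2_field P Q G"
  shows "F = G"
proof
  fix w :: "real \<times> real"
  obtain u v where w: "w = (u, v)" by (cases w)
  have off: "F (x, y) = G (x, y)" if "y \<noteq> 0" for x y
    using assms that polynomial_field_degree_unique
    unfolding chart_U2_field_def by (metis (no_types, lifting))
  have "isCont F (u, 0)" "isCont G (u, 0)"
    using assms by (auto simp: chart_U2_field_def continuous_on_eq_continuous_at)
  moreover have "(\<lambda>k. (u, inverse (real (Suc k)))) \<longlonglongrightarrow> (u, 0)"
    by (intro tendsto_Pair tendsto_const LIMSEQ_inverse_real_of_nat)
  ultimately have "(\<lambda>k. F (u, inverse (real (Suc k)))) \<longlonglongrightarrow> F (u, 0)"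
    and "(\<lambda>k. G (u, inverse (real (Suc k)))) \<longlonglongrightarrow> G (u, 0)"
    by (auto intro: isCont_tendsto_compose)
  moreover have "(\<lambda>k. F (u, inverse (real (Suc k)))) = (\<lambda>k. G (u, inverse (real (Suc k))))"
    by (intro ext off) simp
  ultimately have "F (u, 0) = G (u, 0)"
    using LIMSEQ_unique by metis
  then show "F w = G w" using off w by (cases "v = 0") auto
qed

definition ode_solution ::
  "('a::real_normed_vector \<Rightarrow> 'a) \<Rightarrow> real set \<Rightarrow> (real \<Rightarrow> 'a) \<Rightarrow> bool" where
  "ode_solution F I \<phi> \<longleftrightarrow> (\<forall>t\<in>I. (\<phi> has_vector_derivative F (\<phi> t)) (at t within I))"

definition isolated_critical_point ::
  "('a::real_normed_vector \<Rightarrow> 'a) \<Rightarrow> 'a \<Rightarrow> bool" where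
  "isolated_critical_point F z0 \<longleftrightarrow> F z0 = 0 \<and> (\<forall>\<^sub>F z in at z0. F z \<noteq> 0)"

text \<open>
  The limiting tangent direction is the limit of the unit secant vectors. As \<open>sgn 0 = 0\<close>, the
  condition also excludes curves that sit at the limit point.
\<close>

definition tends_with_tangent ::
  "(real \<Rightarrow> 'a::real_normed_vector) \<Rightarrow> 'a \<Rightarrow> real filter \<Rightarrow> bool" where
  "tends_with_tangent \<phi> z0 A \<longleftrightarrow>
     (\<phi> \<longlongrightarrow> z0) A \<and> (\<exists>e. norm e = 1 \<and> ((\<lambda>t. sgn (\<phi> t - z0)) \<longlongrightarrow> e) A)"

text \<open>
  Existence of a solution on the whole half-line is required explicitly: no nearby orbit may
  leave in finite time, and the condition on solutions is never vacuous.
\<close>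

definition stable_node ::
  "('a::real_normed_vector \<Rightarrow> 'a) \<Rightarrow> 'a \<Rightarrow> bool" where
  "stable_node F z0 \<longleftrightarrow> isolated_critical_point F z0 \<and>
     (\<exists>\<delta>>0. \<forall>z. z \<noteq> z0 \<and> dist z z0 < \<delta> \<longrightarrow>
        (\<exists>\<phi>. ode_solution F {0..} \<phi> \<and> \<phi> 0 = z) \<and>
        (\<forall>\<phi>. ode_solution F {0..} \<phi> \<and> \<phi> 0 = z \<longrightarrow> tends_with_tangent \<phi> z0 at_top))"

definition unstable_node ::
  "('a::real_normed_vector \<Rightarrow> 'a) \<Rightarrow> 'a \<Rightarrow> bool" where
  "unstable_node F z0 \<longleftrightarrow> isolated_critical_point F z0 \<and>
     (\<exists>\<delta>>0. \<forall>z. z \<noteq> z0 \<and> dist z z0 < \<delta> \<longrightarrow>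
        (\<exists>\<phi>. ode_solution F {..0} \<phi> \<and> \<phi> 0 = z) \<and>
        (\<forall>\<phi>. ode_solution F {..0} \<phi> \<and> \<phi> 0 = z \<longrightarrow> tends_with_tangent \<phi> z0 at_bot))"

end

theory Submission
  imports Defs
begin

text \<open>
  Write the chart field as \<open>(v + u * h, v * h)\<close> with \<open>h = A * u * v + c * u\<^sup>2 - d * v / 2\<close> and
  \<open>A = 3 / 2 * a\<^sup>2\<close>. Let \<open>c < 0\<close>. Off the invariant line \<open>v = 0\<close> every solution satisfies
  \<open>u / v = x0 + t\<close>, so everything reduces to the scalar equation
  \<open>y * y' = d / 2 * y - A * x - c * x\<^sup>2\<close> for \<open>y = 1 / v\<close> as a function of \<open>x = x0 + t\<close>.
  Barriers show that its solutions with large initial value never vanish, and that \<open>y / x\<close> tends to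
  infinity along each global solution; hence \<open>u = x / y\<close> and \<open>v = u / x\<close> tend to 0 with \<open>v / u\<close>
  tending to 0. On \<open>v = 0\<close> the equation is \<open>u' = c * u ^ 3\<close>. The symmetry \<open>z \<mapsto> - z\<close> changes
  the sign of \<open>d\<close> and covers \<open>v < 0\<close>; the reflection \<open>v \<mapsto> - v\<close> together with time reversal
  changes the sign of \<open>c\<close> and turns the stable case into the unstable one.
\<close>

subsection \<open>Scalar and Banach-valued differential equations\<close>

text \<open>Any right endpoint beyond \<open>t\<close> gives the same filter at \<open>t\<close>;
  this carries calculus on compact intervals over to the half-line.\<close>

lemma at_within_atLeastAtMost_Suc:
  fixes a t :: real
  shows "at t within {a..t + 1} = at t within {a..}"
  by (rule at_within_nhd[of _ "{..<t + 1}"]) auto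

text \<open>At the first time \<open>s\<close> with \<open>g s \<le> 0\<close> the intermediate
  value theorem forces \<open>g s = 0\<close>, and a positive derivative there makes
  \<open>g\<close> negative just before \<open>s\<close>, a contradiction. Barrier arguments thus
  need the sign of the derivative only at points of contact.\<close>

lemma pos_if_deriv_pos_at_zeros:
  fixes g g' :: "real \<Rightarrow> real"
  assumes deriv: "\<And>s. s \<in> {a..b} \<Longrightarrow> (g has_real_derivative g' s) (at s within {a..b})"
    and start: "g a > 0"
    and zero: "\<And>s. s \<in> {a..b} \<Longrightarrow> g s = 0 \<Longrightarrow> g' s > 0"
    and t: "t \<in> {a..b}"
  shows "g t > 0"
proof (rule ccontr)
  assume neg: "\<not> g t > 0"
  have cont: "continuous_on {a..b} g"
    by (rule DERIV_continuous_on) (rule deriv)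
  define S where "S = {a..b} \<inter> g -` {..0}"
  have "closed S"
    unfolding S_def by (intro continuous_closed_preimage cont) auto
  then have "compact S"
    unfolding S_def by (metis Int_commute compact_Icc compact_Int_closed inf.right_idem)
  moreover have "t \<in> S"
    using neg t by (auto simp: S_def)
  ultimately obtain s where s: "s \<in> S" and least: "\<And>r. r \<in> S \<Longrightarrow> s \<le> r"
    using compact_attains_inf[of S] by blast
  have sab: "s \<in> {a..b}" and gs: "g s \<le> 0" and "a < s"
    using s start by (auto simp: S_def order_le_less)
  have "continuous_on {a..s} g"
    by (rule continuous_on_subset[OF cont]) (use sab in auto)
  then obtain r where r: "a \<le> r" "r \<le> s" "g r = 0"
    using IVT2'[of g s 0 a] start gs sab by force
  then have "r = s"
    using least[of r] sab by (auto simp: S_def)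
  then have "g' s > 0"
    using r zero sab by blast
  then obtain e where e: "e > 0" "\<And>h. h > 0 \<Longrightarrow> s - h \<in> {a..b} \<Longrightarrow> h < e \<Longrightarrow> g (s - h) < g s"
    using has_real_derivative_pos_inc_left[OF deriv[OF sab]] by blast
  define h where "h = min (e / 2) (s - a)"
  have h: "h > 0" "s - h \<in> {a..b}" "h < e"
    using e(1) \<open>a < s\<close> sab by (auto simp: h_def)
  then have "g (s - h) < 0"
    using e(2) gs by fastforce
  then show False
    using least[of "s - h"] h by (auto simp: S_def)
qed

lemma integral_has_vector_derivative_atLeast:
  fixes g :: "real \<Rightarrow> 'a::banach"
  assumes "continuous_on {a..} g" "t \<ge> a"
  shows "((\<lambda>r. integral {a..r} g) has_vector_derivative g t) (at t within {a..})"
  using integral_has_vector_derivative[of a "t + 1" g t] assms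
    continuous_on_subset[OF assms(1), of "{a..t + 1}"]
  by (simp add: at_within_atLeastAtMost_Suc)

text \<open>Integrating factor: \<open>v s * exp (- integral {0..s} h)\<close> has derivative zero.
  The formula yields both preservation of sign and invariance of the zero solution.\<close>

lemma linear_ode_explicit:
  fixes v h :: "real \<Rightarrow> real"
  assumes deriv: "\<And>s. s \<ge> 0 \<Longrightarrow> (v has_real_derivative h s * v s) (at s within {0..})"
    and cont: "continuous_on {0..} h" and t: "t \<ge> 0"
  shows "v t = v 0 * exp (integral {0..t} h)"
proof -
  define w where "w = (\<lambda>s. v s * exp (- integral {0..s} h))"
  have "(w has_real_derivative 0) (at s within {0..})" if "s \<in> {0..}" for s
  proof -
    have "((\<lambda>r. integral {0..r} h) has_real_derivative h s) (at s within {0..})"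
      using integral_has_vector_derivative_atLeast[OF cont] that
      by (simp add: has_real_derivative_iff_has_vector_derivative)
    then show ?thesis
      unfolding w_def using that by (auto intro!: derivative_eq_intros deriv)
  qed
  then obtain k where "\<forall>s\<in>{0..}. w s = k"
    using has_field_derivative_zero_constant[of "{0..}" w] by auto
  then have "w t = w 0"
    using t by simp
  then show ?thesis
    by (simp add: w_def exp_minus field_simps)
qed

text \<open>The majorant integrates to \<open>M / K * exp (K * t) - M / K\<close>; dropping the last
  term leaves a pure exponential, which the weight \<open>exp (- K * t)\<close> can cancel.\<close>

lemma norm_integral_le_exp:
  fixes g :: "real \<Rightarrow> 'a::banach"
  assumes "K > 0" "0 \<le> M" "0 \<le> t" and cont: "continuous_on {0..t} g"
    and bound: "\<And>s. s \<in> {0..t} \<Longrightarrow> norm (g s) \<le> M * exp (K * s)"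
  shows "norm (integral {0..t} g) \<le> M / K * exp (K * t)"
proof -
  have "((\<lambda>s. M * exp (K * s)) has_integral (M / K * exp (K * t) - M / K * exp (K * 0))) {0..t}"
    using assms(1,3)
    by (intro fundamental_theorem_of_calculus)
       (auto intro!: derivative_eq_intros simp flip: has_real_derivative_iff_has_vector_derivative)
  then have int: "integral {0..t} (\<lambda>s. M * exp (K * s)) = M / K * exp (K * t) - M / K * exp (K * 0)"
    by (rule integral_unique)
  have "norm (integral {0..t} g) \<le> integral {0..t} (\<lambda>s. M * exp (K * s))"
    by (intro integral_norm_bound_integral integrable_continuous_real cont bound continuous_intros)
  moreover have "0 \<le> M / K * exp (K * 0)"
    using assms(1,2) by simp
  ultimately show ?thesis
    unfolding int by linarith
qed

text \<open>
  The weight \<open>exp (- K t)\<close> turns the integral operator into a contraction with factor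
  \<open>L / K\<close> on the whole half-line, so no continuation of local solutions is needed.
\<close>

lemma global_solution_exists:
  fixes f :: "real \<Rightarrow> 'a::banach \<Rightarrow> 'a"
  assumes cont: "continuous_on ({0..} \<times> UNIV) (\<lambda>(t, x). f t x)"
    and lip: "\<And>t x y. t \<ge> 0 \<Longrightarrow> norm (f t x - f t y) \<le> L * norm (x - y)"
    and growth: "\<And>t. t \<ge> 0 \<Longrightarrow> norm (f t 0) \<le> C * exp (K * t)"
    and LK: "0 \<le> L" "L < K"
  obtains \<phi> where "\<phi> 0 = x0"
    and "\<And>t. t \<ge> 0 \<Longrightarrow> (\<phi> has_vector_derivative f t (\<phi> t)) (at t within {0..})"
proof -
  have K: "K > 0" and C: "0 \<le> C"
    using LK growth[of 0] order_trans[OF norm_ge_zero] by auto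
  \<comment> \<open>\<open>\<psi>\<close> is the weighted unknown: the solution will be
    \<open>exp (K * s) *\<^sub>R \<psi> s\<close>. Bounded continuous functions live on the whole
    line here, so \<open>max 0 t\<close> in \<open>\<Phi>\<close> extends the operator constantly to
    negative times.\<close>
  define g where "g = (\<lambda>(\<psi> :: real \<Rightarrow>\<^sub>C 'a) s. f s (exp (K * s) *\<^sub>R \<psi> s))"
  define \<Phi> where "\<Phi> = (\<lambda>\<psi> t. exp (- K * max 0 t) *\<^sub>R (x0 + integral {0..max 0 t} (g \<psi>)))"
  have gcont: "continuous_on {0..} (g \<psi>)" for \<psi>
  proof -
    have "continuous_on {0..} (\<lambda>s. (s, exp (K * s) *\<^sub>R \<psi> s))"
      by (intro continuous_intros continuous_on_apply_bcontfun)
    from continuous_on_compose2[OF cont this] show ?thesis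
      by (simp add: g_def image_subset_iff)
  qed
  have gcont': "continuous_on {0..t} (g \<psi>)" for \<psi> t
    by (rule continuous_on_subset[OF gcont]) auto
  have icont: "continuous_on {0..} (\<lambda>t. integral {0..t} (g \<psi>))" for \<psi>
    unfolding continuous_on_eq_continuous_within
    using integral_has_vector_derivative_atLeast[OF gcont]
    by (auto intro: has_vector_derivative_continuous)
  have "\<Phi> \<psi> \<in> bcontfun" for \<psi>
  proof (rule bcontfun_normI)
    have "continuous_on UNIV (\<lambda>t. integral {0..max 0 t} (g \<psi>))"
      by (rule continuous_on_compose2[OF icont]) (auto intro!: continuous_intros)
    then show "continuous_on UNIV (\<Phi> \<psi>)"
      unfolding \<Phi>_def by (intro continuous_intros)
    fix t :: real
    define \<tau> where "\<tau> = max 0 t"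
    have \<tau>: "\<tau> \<ge> 0" by (simp add: \<tau>_def)
    have "norm (g \<psi> s) \<le> (C + L * norm \<psi>) * exp (K * s)" if "s \<in> {0..\<tau>}" for s
    proof -
      have "norm (g \<psi> s) \<le> norm (f s 0) + norm (g \<psi> s - f s 0)"
        by (metis add.commute diff_add_cancel norm_triangle_ineq)
      also have "norm (g \<psi> s - f s 0) \<le> L * (exp (K * s) * norm (\<psi> s))"
        using lip[of s "exp (K * s) *\<^sub>R \<psi> s" 0] that by (simp add: g_def)
      also have "\<dots> \<le> L * (exp (K * s) * norm \<psi>)"
        using LK by (intro mult_left_mono norm_bounded) auto
      finally show ?thesis
        using growth[of s] that by (simp add: algebra_simps)
    qed
    then have "norm (integral {0..\<tau>} (g \<psi>)) \<le> (C + L * norm \<psi>) / K * exp (K * \<tau>)"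
      using K C LK \<tau> by (intro norm_integral_le_exp gcont') auto
    then have "norm (x0 + integral {0..\<tau>} (g \<psi>)) \<le> norm x0 * exp (K * \<tau>) + (C + L * norm \<psi>) / K * exp (K * \<tau>)"
      using K \<tau> by (intro norm_triangle_le add_mono) (auto intro: mult_le_cancel_left1[THEN iffD2])
    then have "exp (- K * \<tau>) * norm (x0 + integral {0..\<tau>} (g \<psi>))
      \<le> exp (- K * \<tau>) * ((norm x0 + (C + L * norm \<psi>) / K) * exp (K * \<tau>))"
      by (intro mult_left_mono) (auto simp: algebra_simps)
    also have "\<dots> = norm x0 + (C + L * norm \<psi>) / K"
      by (simp add: exp_minus)
    finally show "norm (\<Phi> \<psi> t) \<le> norm x0 + (C + L * norm \<psi>) / K"
      by (simp add: \<Phi>_def \<tau>_def)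
  qed
  then have app: "apply_bcontfun (Bcontfun (\<Phi> \<psi>)) = \<Phi> \<psi>" for \<psi>
    by (simp add: Bcontfun_inverse)
  have "dist (Bcontfun (\<Phi> \<psi>)) (Bcontfun (\<Phi> \<zeta>)) \<le> L / K * dist \<psi> \<zeta>" for \<psi> \<zeta>
  proof (rule dist_bound, unfold app)
    fix t :: real
    define \<tau> where "\<tau> = max 0 t"
    have \<tau>: "\<tau> \<ge> 0" by (simp add: \<tau>_def)
    have "norm (g \<psi> s - g \<zeta> s) \<le> (L * dist \<psi> \<zeta>) * exp (K * s)" if "s \<in> {0..\<tau>}" for s
    proof -
      have "norm (g \<psi> s - g \<zeta> s) \<le> L * (exp (K * s) * dist (\<psi> s) (\<zeta> s))"
        using lip[of s "exp (K * s) *\<^sub>R \<psi> s" "exp (K * s) *\<^sub>R \<zeta> s"] that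
        by (simp add: g_def dist_norm flip: scaleR_diff_right)
      also have "\<dots> \<le> L * (exp (K * s) * dist \<psi> \<zeta>)"
        using LK by (intro mult_left_mono dist_bounded) auto
      finally show ?thesis by (simp add: mult_ac)
    qed
    then have "norm (integral {0..\<tau>} (\<lambda>s. g \<psi> s - g \<zeta> s)) \<le> L * dist \<psi> \<zeta> / K * exp (K * \<tau>)"
      using K LK \<tau> by (intro norm_integral_le_exp continuous_intros gcont') auto
    then have "exp (- K * \<tau>) * norm (integral {0..\<tau>} (g \<psi>) - integral {0..\<tau>} (g \<zeta>))
        \<le> exp (- K * \<tau>) * (L * dist \<psi> \<zeta> / K * exp (K * \<tau>))"
      by (intro mult_left_mono)
         (auto simp: integral_diff integrable_continuous_real gcont')
    also have "\<dots> = L / K * dist \<psi> \<zeta>"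
      by (simp add: exp_minus)
    finally show "dist (\<Phi> \<psi> t) (\<Phi> \<zeta> t) \<le> L / K * dist \<psi> \<zeta>"
      by (simp add: \<Phi>_def \<tau>_def dist_norm flip: scaleR_diff_right)
  qed
  then obtain \<psi> where fix_eq: "Bcontfun (\<Phi> \<psi>) = \<psi>"
    using banach_fix_type[of "L / K" "\<lambda>\<psi>. Bcontfun (\<Phi> \<psi>)"] LK K by auto
  then have \<psi>: "apply_bcontfun \<psi> = \<Phi> \<psi>"
    by (metis app)
  define \<phi> where "\<phi> = (\<lambda>t. x0 + integral {0..t} (g \<psi>))"
  have eq: "exp (K * t) *\<^sub>R \<psi> t = \<phi> t" if "t \<ge> 0" for t
    using that by (simp add: \<psi> \<Phi>_def \<phi>_def flip: exp_add)
  show ?thesis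
  proof
    show "\<phi> 0 = x0" by (simp add: \<phi>_def)
    show "(\<phi> has_vector_derivative f t (\<phi> t)) (at t within {0..})" if "t \<ge> 0" for t
    proof -
      have "f t (\<phi> t) = g \<psi> t"
        using eq that by (simp add: g_def)
      then show ?thesis
        unfolding \<phi>_def
        using integral_has_vector_derivative_atLeast[OF gcont that] 
        by (auto intro!: derivative_eq_intros)
    qed
  qed
qed

subsection \<open>Nodes under isometries and time reversal\<close>

text \<open>\<open>sgn\<close> commutes with a norm-preserving linear map, so the limiting direction
  \<open>e\<close> becomes \<open>R e\<close>.\<close>

lemma tends_with_tangent_isometry:
  assumes "bounded_linear R" and norm_R: "\<And>z. norm (R z) = norm z"
    and tends: "tends_with_tangent \<phi> 0 G"
  shows "tends_with_tangent (\<lambda>t. R (\<phi> t)) 0 G"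
proof -
  interpret R: bounded_linear R by fact
  obtain e where e: "norm e = 1" "((\<lambda>t. sgn (\<phi> t)) \<longlongrightarrow> e) G"
    using tends by (auto simp: tends_with_tangent_def)
  have "((\<lambda>t. R (\<phi> t)) \<longlongrightarrow> 0) G"
    using R.tendsto_zero tends by (auto simp: tends_with_tangent_def)
  moreover have "((\<lambda>t. sgn (R (\<phi> t))) \<longlongrightarrow> R e) G"
    using R.tendsto[OF e(2)] by (simp add: sgn_div_norm R.scaleR norm_R)
  moreover have "norm (R e) = 1"
    using e(1) norm_R by simp
  ultimately show ?thesis
    by (auto simp: tends_with_tangent_def)
qed

lemma tends_with_tangent_reverse:
  assumes "tends_with_tangent \<phi> z at_top"
  shows "tends_with_tangent (\<lambda>t. \<phi> (- t)) z at_bot"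
  using assms unfolding tends_with_tangent_def
  by (auto simp: filterlim_at_bot_mirror)

lemma ode_solution_linear_image:
  assumes "bounded_linear R" "\<And>z. G (R z) = R (F z)" "ode_solution F I \<phi>"
  shows "ode_solution G I (\<lambda>t. R (\<phi> t))"
  using assms bounded_linear.has_vector_derivative unfolding ode_solution_def by fastforce

lemma ode_solution_reverse:
  assumes "ode_solution F (uminus ` I) \<phi>"
  shows "ode_solution (\<lambda>z. - F z) I (\<lambda>t. \<phi> (- t))"
  unfolding ode_solution_def
proof
  fix t assume "t \<in> I"
  then have "(\<phi> has_vector_derivative F (\<phi> (- t))) (at (- t) within uminus ` I)"
    using assms by (auto simp: ode_solution_def)
  moreover have "(uminus has_vector_derivative (- 1 :: real)) (at t within I)"
    by (auto intro!: derivative_eq_intros)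
  ultimately show "((\<lambda>t. \<phi> (- t)) has_vector_derivative - F (\<phi> (- t))) (at t within I)"
    using vector_diff_chain_within[of uminus "-1" t I \<phi> "F (\<phi> (- t))"] by (simp add: o_def)
qed

text \<open>Since \<open>R\<close> is an involution, sending \<open>\<phi>\<close> to
  \<open>\<lambda>t. R (\<phi> (- t))\<close> exchanges forward solutions of \<open>G\<close> and
  backward solutions of \<open>F\<close> in both directions. As \<open>R\<close> preserves norms,
  the same radius serves both fields.\<close>

lemma unstable_node_of_stable_node:
  assumes G: "stable_node G 0" and "bounded_linear R"
    and norm_R: "\<And>z. norm (R z) = norm z" and inv: "\<And>z. R (R z) = z"
    and conj: "\<And>z. F (R z) = - R (G z)"
  shows "unstable_node F 0"
proof -
  interpret R: bounded_linear R by fact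
  obtain \<epsilon> where \<epsilon>: "\<epsilon> > 0" "\<And>z. z \<noteq> 0 \<Longrightarrow> norm z < \<epsilon> \<Longrightarrow> G z \<noteq> 0" and "G 0 = 0"
    using G by (auto simp: stable_node_def isolated_critical_point_def eventually_at)
  obtain \<delta> where \<delta>: "\<delta> > 0"
    and exists: "\<And>z. z \<noteq> 0 \<Longrightarrow> norm z < \<delta> \<Longrightarrow> \<exists>\<phi>. ode_solution G {0..} \<phi> \<and> \<phi> 0 = z"
    and tends: "\<And>\<phi>. \<phi> 0 \<noteq> 0 \<Longrightarrow> norm (\<phi> 0) < \<delta> \<Longrightarrow> ode_solution G {0..} \<phi>
      \<Longrightarrow> tends_with_tangent \<phi> 0 at_top"
    using G unfolding stable_node_def dist_0_norm dist_norm diff_zero by blast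
  have F: "F z = - R (G (R z))" for z
    using conj[of "R z"] by (simp add: inv)
  have R0: "R z = 0 \<longleftrightarrow> z = 0" for z
    using norm_R by (metis norm_eq_zero)
  have isolated: "isolated_critical_point F 0"
    unfolding isolated_critical_point_def eventually_at
    using \<epsilon> \<open>G 0 = 0\<close> by (auto simp: F R.zero R0 norm_R intro!: exI[of _ \<epsilon>])
  have fwd: "ode_solution F {..0} (\<lambda>t. R (\<phi> (- t)))" if "ode_solution G {0..} \<phi>" for \<phi>
    by (rule ode_solution_linear_image[OF \<open>bounded_linear R\<close> _ ode_solution_reverse])
       (use that conj in \<open>auto simp: R.neg\<close>)
  have bwd: "ode_solution G {0..} (\<lambda>t. R (\<phi> (- t)))" if "ode_solution F {..0} \<phi>" for \<phi>
    by (rule ode_solution_linear_image[OF \<open>bounded_linear R\<close> _ ode_solution_reverse])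
       (use that in \<open>auto simp: F R.neg inv\<close>)
  have "\<exists>\<phi>. ode_solution F {..0} \<phi> \<and> \<phi> 0 = z" if z: "z \<noteq> 0" "norm z < \<delta>" for z
  proof -
    obtain \<phi> where "ode_solution G {0..} \<phi>" "\<phi> 0 = R z"
      using exists[of "R z"] z by (auto simp: R0 norm_R)
    then show ?thesis
      using fwd by (intro exI[of _ "\<lambda>t. R (\<phi> (- t))"]) (simp add: inv)
  qed
  moreover have "tends_with_tangent \<phi> 0 at_bot"
    if \<phi>: "\<phi> 0 \<noteq> 0" "norm (\<phi> 0) < \<delta>" "ode_solution F {..0} \<phi>" for \<phi>
  proof -
    have "tends_with_tangent (\<lambda>t. R (\<phi> (- t))) 0 at_top"
      using \<phi> by (intro tends bwd) (auto simp: R0 norm_R)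
    from tends_with_tangent_isometry[OF \<open>bounded_linear R\<close> norm_R this]
    show ?thesis
      using tends_with_tangent_reverse by (fastforce simp: inv)
  qed
  ultimately show ?thesis
    unfolding unstable_node_def using isolated \<delta> by (auto intro!: exI[of _ \<delta>])
qed

subsection \<open>The chart field and its symmetries\<close>

text \<open>The logarithmic derivative of \<open>v\<close> along solutions off \<open>v = 0\<close>;
  in the affine coordinate \<open>y = 1 / v\<close> it is \<open>- y' / y\<close>.\<close>

definition radial_rate :: "real \<Rightarrow> real \<Rightarrow> real \<Rightarrow> real \<Rightarrow> real \<Rightarrow> real" where
  "radial_rate d A c u v = A * u * v + c * u\<^sup>2 - d * v / 2"

definition chart_field :: "real \<Rightarrow> real \<Rightarrow> real \<Rightarrow> real \<times> real \<Rightarrow> real \<times> real" where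
  "chart_field d A c = (\<lambda>(u, v). (v + u * radial_rate d A c u v, v * radial_rate d A c u v))"

lemma chart_field_uminus: "chart_field (- d) A c (- z) = - chart_field d A c z"
  by (cases z) (simp add: chart_field_def radial_rate_def algebra_simps)

text \<open>Replacing \<open>v\<close> by \<open>- v\<close> in \<open>radial_rate\<close> amounts
  to negating both \<open>c\<close> and the whole rate. The statement has the shape of the conjugacy
  in \<open>unstable_node_of_stable_node\<close>.\<close>

lemma chart_field_reflect:
  "chart_field d A c (fst z, - snd z) = - (fst (chart_field d A (- c) z), - snd (chart_field d A (- c) z))"
  by (cases z) (simp add: chart_field_def radial_rate_def algebra_simps)

text \<open>Off \<open>v = 0\<close> the second component kills the rate, and then the first
  component is \<open>v\<close> itself; on \<open>v = 0\<close> the first component is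
  \<open>c * u ^ 3\<close>.\<close>

lemma chart_field_eq_0_iff:
  assumes "c \<noteq> 0"
  shows "chart_field d A c z = 0 \<longleftrightarrow> z = 0"
proof (cases z)
  case (Pair u v)
  have "u = 0 \<and> v = 0" if "v + u * radial_rate d A c u v = 0" "v * radial_rate d A c u v = 0"
  proof (cases "v = 0")
    case True
    then show ?thesis using that assms by (simp add: radial_rate_def)
  next
    case False
    then show ?thesis using that by simp
  qed
  then show ?thesis
    using Pair by (auto simp: chart_field_def zero_prod_def)
qed

text \<open>The second equation is written as rate times \<open>v t\<close> so that
  \<open>linear_ode_explicit\<close> applies to it directly.\<close>

lemma ode_solution_chart_field_iff:
  "ode_solution (chart_field d A c) I (\<lambda>t. (u t, v t)) \<longleftrightarrow>
    (\<forall>t\<in>I. (u has_real_derivative v t + u t * radial_rate d A c (u t) (v t)) (at t within I) \<and>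
           (v has_real_derivative radial_rate d A c (u t) (v t) * v t) (at t within I))"
proof -
  have "((\<lambda>t. (u t, v t)) has_vector_derivative (x, y)) (at t within I) \<longleftrightarrow>
      (u has_real_derivative x) (at t within I) \<and> (v has_real_derivative y) (at t within I)" for x y t
    using bounded_linear.has_vector_derivative[OF bounded_linear_fst, of "\<lambda>t. (u t, v t)" "(x, y)" "at t within I"]
      bounded_linear.has_vector_derivative[OF bounded_linear_snd, of "\<lambda>t. (u t, v t)" "(x, y)" "at t within I"]
    unfolding has_real_derivative_iff_has_vector_derivative
    by (auto intro: has_vector_derivative_Pair)
  then show ?thesis
    by (simp add: ode_solution_def chart_field_def mult.commute)
qed

subsection \<open>Convergence of global solutions\<close>

text \<open>Dividing the vector by \<open>u t > 0\<close> does not change its direction, and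
  \<open>sgn\<close> is continuous at \<open>(1, 0)\<close>.\<close>

lemma sgn_Pair_tendsto:
  fixes u v :: "'a \<Rightarrow> real"
  assumes u: "\<forall>\<^sub>F t in G. u t > 0" and ratio: "((\<lambda>t. v t / u t) \<longlongrightarrow> 0) G"
  shows "((\<lambda>t. sgn (u t, v t)) \<longlongrightarrow> (1, 0)) G"
proof -
  have "((\<lambda>t. sgn (1 :: real, v t / u t)) \<longlongrightarrow> sgn (1, 0)) G"
    by (intro tendsto_sgn tendsto_Pair tendsto_const ratio) (simp add: zero_prod_def)
  then have "((\<lambda>t. sgn (1 :: real, v t / u t)) \<longlongrightarrow> (1, 0)) G"
    by (simp add: sgn_div_norm norm_Pair)
  moreover have "\<forall>\<^sub>F t in G. sgn (1, v t / u t) = sgn (u t, v t)"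
    using u
  proof eventually_elim
    case (elim t)
    have "sgn (u t, v t) = sgn (u t *\<^sub>R (1 :: real, v t / u t))"
      using elim by simp
    also have "\<dots> = sgn (1, v t / u t)"
      using elim by (simp only: sgn_scaleR) simp
    finally show ?case ..
  qed
  ultimately show ?thesis
    by (rule Lim_transform_eventually)
qed

text \<open>
  The chart coordinate \<open>x = u / v\<close> satisfies \<open>x' = 1\<close> along every solution off the line at
  infinity; hence the factor \<open>u 0 / v 0 + t\<close>.
\<close>

lemma chart_field_solution_off_infinity:
  assumes sol: "ode_solution (chart_field d A c) {0..} (\<lambda>t. (u t, v t))"
    and v0: "v 0 > 0" and t: "t \<ge> 0"
  shows "v t > 0" "u t = (u 0 / v 0 + t) * v t"
proof -
  define h where "h = (\<lambda>t. radial_rate d A c (u t) (v t))"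
  have du: "(u has_real_derivative v t + u t * h t) (at t within {0..})"
    and dv: "(v has_real_derivative h t * v t) (at t within {0..})" if "t \<ge> 0" for t
    using sol that by (auto simp: ode_solution_chart_field_iff h_def)
  have cont: "continuous_on {0..} u" "continuous_on {0..} v"
    using du dv by (auto intro!: DERIV_continuous_on)
  then have h: "continuous_on {0..} h"
    unfolding h_def radial_rate_def by (intro continuous_intros) auto
  show "v t > 0"
    using linear_ode_explicit[of v h t] dv h t v0 by simp
  \<comment> \<open>The defect \<open>w\<close> satisfies the same linear equation
    \<open>w' = h * w\<close> as \<open>v\<close> and starts at 0, so it vanishes; no quotient has
    to be differentiated.\<close>
  define w where "w = (\<lambda>t. u t - (u 0 / v 0 + t) * v t)"
  have "(w has_real_derivative h t * w t) (at t within {0..})" if "t \<ge> 0" for t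
    unfolding w_def
    by (rule derivative_eq_intros du dv that refl)+ (simp add: algebra_simps)
  then have "w t = w 0 * exp (integral {0..t} h)"
    using h t by (rule linear_ode_explicit)
  then show "u t = (u 0 / v 0 + t) * v t"
    using v0 by (simp add: w_def)
qed

text \<open>
  In the affine coordinates \<open>x = u / v\<close>, \<open>y = 1 / v\<close> the claim says that \<open>y / x\<close> exceeds \<open>1 / e\<close>
  eventually. The line \<open>y = M * (x - x1)\<close> is a barrier from below once \<open>x1\<close> is large, because
  \<open>y' = d / 2 - (A * x + c * x\<^sup>2) / y\<close> grows linearly in \<open>x\<close> on it.
\<close>

lemma chart_field_u_small:
  assumes sol: "ode_solution (chart_field d A c) {0..} (\<lambda>t. (u t, v t))"
    and v0: "v 0 > 0" and c: "c < 0" and e: "e > 0"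
  shows "\<forall>\<^sub>F t in at_top. 0 < u t \<and> u t < e"
proof -
  define x0 where "x0 = u 0 / v 0"
  \<comment> \<open>The factor 2 pays for replacing \<open>x - x1\<close> by \<open>x\<close> at the
    end: \<open>x \<le> 2 * (x - x1)\<close> once \<open>x \<ge> 2 * x1\<close>.\<close>
  define M where "M = 2 / e"
  have M: "M > 0" using e by (simp add: M_def)
  \<comment> \<open>The last entry makes the derivative inequality hold at contact with the barrier;
    \<open>x1 \<ge> x0\<close> makes the barrier start at a nonnegative time.\<close>
  define x1 where "x1 = max 1 (max x0 (((\<bar>d\<bar> / 2 + M) * M + \<bar>A\<bar> + 1) / (- c)))"
  have x1: "x1 \<ge> 1" "x1 \<ge> x0" "((\<bar>d\<bar> / 2 + M) * M + \<bar>A\<bar> + 1) / (- c) \<le> x1"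
    by (auto simp: x1_def)
  then have cx1: "- c * x1 - A > (\<bar>d\<bar> / 2 + M) * M"
    using c by (simp add: field_simps)
  have v: "v t > 0" and uv: "u t = (x0 + t) * v t" if "t \<ge> 0" for t
    using chart_field_solution_off_infinity[OF sol v0 that] by (auto simp: x0_def)
  have dv: "(v has_real_derivative radial_rate d A c (u t) (v t) * v t) (at t within {0..})" if "t \<ge> 0" for t
    using sol that by (simp add: ode_solution_chart_field_iff)
  have barrier: "M * (x0 + t - x1) * v t < 1" if t: "t \<ge> x1 - x0" for t
  proof -
    \<comment> \<open>This is \<open>y - M * (x - x1)\<close> multiplied by
      \<open>v = 1 / y\<close>. It equals 1 at the start, where \<open>x = x1\<close>.\<close>
    define g where "g = (\<lambda>s. 1 - M * (x0 + s - x1) * v s)"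
    define g' where "g' = (\<lambda>s. - M * v s - M * (x0 + s - x1) * (radial_rate d A c (u s) (v s) * v s))"
    have "g t > 0"
    proof (rule pos_if_deriv_pos_at_zeros[of "x1 - x0" t g g'])
      fix s assume s: "s \<in> {x1 - x0..t}"
      then have s0: "s \<ge> 0" using x1 by simp
      have "(v has_real_derivative radial_rate d A c (u s) (v s) * v s) (at s within {x1 - x0..t})"
        by (rule DERIV_subset[OF dv[OF s0]]) (use x1 in auto)
      then show "(g has_real_derivative g' s) (at s within {x1 - x0..t})"
        unfolding g_def g'_def by (auto intro!: derivative_eq_intros simp: algebra_simps)
      assume "g s = 0"
      then have eq: "M * (x0 + s - x1) * v s = 1"
        by (simp add: g_def)
      have "M * u s = 1 + M * x1 * v s"
        using eq by (simp add: uv[OF s0] algebra_simps)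
      then have "M * u s \<ge> 1"
        using M x1 v[OF s0] by simp
      then have "u s \<ge> 1 / M"
        using M by (simp add: field_simps)
      moreover have "- c * (x0 + s) - A \<ge> - c * x1 - A"
        using c s by (simp add: mult_left_mono)
      moreover have "0 \<le> - c * x1 - A"
        by (rule less_imp_le[OF le_less_trans[OF _ cx1]]) (use M in simp)
      moreover have "0 \<le> 1 / M"
        using M by simp
      ultimately have "1 / M * (- c * x1 - A) \<le> u s * (- c * (x0 + s) - A)"
        by (intro mult_mono) linarith+
      moreover have "\<bar>d\<bar> / 2 + M < 1 / M * (- c * x1 - A)"
        using cx1 M by (simp add: field_simps)
      ultimately have "0 < d / 2 - M + u s * (- c * (x0 + s) - A)"
        by linarith
      then have "0 < v s * (d / 2 - M + u s * (- c * (x0 + s) - A))"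
        using v[OF s0] by simp
      \<comment> \<open>Substituting \<open>u = x * v\<close> recovers the rate; the factor
        \<open>M * (x - x1) * v\<close>, which is 1 at contact, is then inserted to reach
        \<open>g' s\<close>.\<close>
      also have "\<dots> = - M * v s - radial_rate d A c (u s) (v s)"
        by (simp add: radial_rate_def uv[OF s0] power2_eq_square algebra_simps)
      also have "\<dots> = - M * v s - M * (x0 + s - x1) * v s * radial_rate d A c (u s) (v s)"
        unfolding eq by simp
      also have "\<dots> = g' s"
        by (simp add: g'_def)
      finally show "g' s > 0" .
    qed (use t in \<open>auto simp: g_def\<close>)
    then show ?thesis by (simp add: g_def)
  qed
  have "0 < u t \<and> u t < e" if t: "t \<ge> 2 * x1 - x0" for t
  proof -
    have t0: "t \<ge> 0" "t \<ge> x1 - x0" using t x1 by auto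
    have "M * (x0 + t) * v t \<le> M * (2 * (x0 + t - x1)) * v t"
      using M v[OF t0(1)] t by (intro mult_right_mono mult_left_mono) auto
    also have "\<dots> = 2 * (M * (x0 + t - x1) * v t)"
      by simp
    also have "\<dots> < 2"
      using barrier[OF t0(2)] by simp
    finally have "M * u t < 2"
      by (simp add: uv[OF t0(1)] mult.assoc)
    moreover have "u t > 0"
      using t x1 v[OF t0(1)] by (simp add: uv[OF t0(1)])
    ultimately show ?thesis
      using e by (simp add: M_def field_simps)
  qed
  then show ?thesis
    unfolding eventually_at_top_linorder by blast
qed

text \<open>Eventually \<open>v / u = 1 / (x0 + t)\<close>, which tends to 0. With \<open>u\<close>
  tending to 0 this gives \<open>v = (v / u) * u\<close> tending to 0 and the direction
  \<open>(1, 0)\<close>.\<close>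

lemma chart_field_tends_upper:
  assumes sol: "ode_solution (chart_field d A c) {0..} (\<lambda>t. (u t, v t))"
    and v0: "v 0 > 0" and c: "c < 0"
  shows "tends_with_tangent (\<lambda>t. (u t, v t)) 0 at_top"
proof -
  define x0 where "x0 = u 0 / v 0"
  note small = chart_field_u_small[OF sol v0 c]
  have upos: "\<forall>\<^sub>F t in at_top. u t > 0"
    using small[of 1] by (auto elim: eventually_mono)
  have u: "(u \<longlongrightarrow> 0) at_top"
  proof (rule tendstoI)
    fix e :: real assume "e > 0"
    from small[OF this] show "\<forall>\<^sub>F t in at_top. dist (u t) 0 < e"
      by eventually_elim auto
  qed
  have "filterlim (\<lambda>t. x0 + t) at_top at_top"
    by (rule filterlim_tendsto_add_at_top[OF tendsto_const filterlim_ident])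
  then have inv: "((\<lambda>t. inverse (x0 + t)) \<longlongrightarrow> 0) at_top"
    by (rule tendsto_inverse_0_at_top)
  have ratio_eq: "\<forall>\<^sub>F t in at_top. inverse (x0 + t) = v t / u t"
    using upos eventually_ge_at_top[of 0]
  proof eventually_elim
    case (elim t)
    then have "v t > 0" "u t = (x0 + t) * v t"
      using chart_field_solution_off_infinity[OF sol v0 elim(2)] by (simp_all add: x0_def)
    moreover from this have "x0 + t > 0"
      using elim(1) by (simp add: zero_less_mult_iff)
    ultimately show ?case
      by (simp add: inverse_eq_divide)
  qed
  have ratio: "((\<lambda>t. v t / u t) \<longlongrightarrow> 0) at_top"
    by (rule Lim_transform_eventually[OF inv ratio_eq])
  have "((\<lambda>t. v t / u t * u t) \<longlongrightarrow> 0) at_top"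
    using tendsto_mult[OF ratio u] by simp
  moreover have "\<forall>\<^sub>F t in at_top. v t / u t * u t = v t"
    using upos by eventually_elim simp
  ultimately have v: "(v \<longlongrightarrow> 0) at_top"
    by (rule Lim_transform_eventually)
  have "((\<lambda>t. (u t, v t)) \<longlongrightarrow> 0) at_top"
    using tendsto_Pair[OF u v] by (simp add: zero_prod_def)
  moreover have "norm (1 :: real, 0 :: real) = 1"
    by (simp add: norm_Pair)
  ultimately show ?thesis
    unfolding tends_with_tangent_def diff_zero
    using sgn_Pair_tendsto[OF upos ratio] by blast
qed

text \<open>The line \<open>v = 0\<close> is invariant and carries \<open>u' = c * u ^ 3\<close>,
  with first integral \<open>1 / u\<^sup>2 + 2 * c * t\<close>. Hence \<open>u\<^sup>2\<close>
  decays like \<open>1 / t\<close>, and the constant sign of \<open>u\<close> fixes the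
  direction.\<close>

lemma chart_field_tends_at_infinity:
  assumes sol: "ode_solution (chart_field d A c) {0..} (\<lambda>t. (u t, v t))"
    and v0: "v 0 = 0" and u0: "u 0 \<noteq> 0" and c: "c < 0"
  shows "tends_with_tangent (\<lambda>t. (u t, v t)) 0 at_top"
proof -
  define h where "h = (\<lambda>t. radial_rate d A c (u t) (v t))"
  have du: "(u has_real_derivative v t + u t * h t) (at t within {0..})"
    and dv: "(v has_real_derivative h t * v t) (at t within {0..})" if "t \<ge> 0" for t
    using sol that by (auto simp: ode_solution_chart_field_iff h_def)
  have cont: "continuous_on {0..} u" "continuous_on {0..} v"
    using du dv by (auto intro!: DERIV_continuous_on)
  then have h: "continuous_on {0..} h"
    unfolding h_def radial_rate_def by (intro continuous_intros) auto
  have v: "v t = 0" if "t \<ge> 0" for t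
    using linear_ode_explicit[of v h t] dv h that v0 by simp
  have du': "(u has_real_derivative h t * u t) (at t within {0..})" if "t \<ge> 0" for t
    using du[OF that] v[OF that] by (simp add: mult.commute)
  have usgn: "sgn (u t) = sgn (u 0)" if "t \<ge> 0" for t
    by (subst linear_ode_explicit[of u h t]) (use du' h that in \<open>auto simp: sgn_mult\<close>)
  then have unz: "u t \<noteq> 0" if "t \<ge> 0" for t
    using u0 that by (metis sgn_eq_0_iff)
  define w where "w = (\<lambda>t. 1 / (u t)\<^sup>2 + 2 * c * t)"
  have "(w has_real_derivative 0) (at t within {0..})" if "t \<in> {0..}" for t
  proof -
    have "h t = c * (u t)\<^sup>2"
      using v that by (simp add: h_def radial_rate_def)
    then show ?thesis
      unfolding w_def using that unz[of t]
      by (auto intro!: derivative_eq_intros du' simp: power2_eq_square)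
  qed
  then obtain k where k: "\<forall>t\<in>{0..}. w t = k"
    using has_field_derivative_zero_constant[of "{0..}" w] by auto
  have u2: "(u t)\<^sup>2 = inverse (w 0 + - 2 * c * t)" if "t \<ge> 0" for t
  proof -
    have "1 / (u t)\<^sup>2 = w 0 + - 2 * c * t"
      using k[rule_format, of t] k[rule_format, of 0] that by (simp add: w_def)
    then show ?thesis
      by (metis inverse_eq_divide inverse_inverse_eq)
  qed
  have "filterlim (\<lambda>t. w 0 + - 2 * c * t) at_top at_top"
    using c by (intro filterlim_tendsto_add_at_top[OF tendsto_const]
        filterlim_tendsto_pos_mult_at_top[OF tendsto_const _ filterlim_ident]) auto
  then have "((\<lambda>t. inverse (w 0 + - 2 * c * t)) \<longlongrightarrow> 0) at_top"
    by (rule tendsto_inverse_0_at_top)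
  moreover have "\<forall>\<^sub>F t in at_top. inverse (w 0 + - 2 * c * t) = (u t)\<^sup>2"
    using eventually_ge_at_top[of 0] by eventually_elim (simp add: u2)
  ultimately have "((\<lambda>t. (u t)\<^sup>2) \<longlongrightarrow> 0) at_top"
    by (rule Lim_transform_eventually)
  from tendsto_real_sqrt[OF this] have "(u \<longlongrightarrow> 0) at_top"
    by (simp add: tendsto_rabs_zero_iff)
  moreover have "(v \<longlongrightarrow> 0) at_top"
  proof (rule Lim_transform_eventually[OF tendsto_const])
    show "\<forall>\<^sub>F t in at_top. 0 = v t"
      using eventually_ge_at_top[of 0] by eventually_elim (simp add: v)
  qed
  ultimately have "((\<lambda>t. (u t, v t)) \<longlongrightarrow> 0) at_top"
    unfolding zero_prod_def by (rule tendsto_Pair)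
  moreover have "\<forall>\<^sub>F t in at_top. (sgn (u 0), 0) = sgn (u t, v t)"
    using eventually_ge_at_top[of 0]
  proof eventually_elim
    case (elim t)
    then show ?case
      using usgn[OF elim] unz[OF elim]
      by (simp add: v sgn_div_norm norm_Pair)
  qed
  then have "((\<lambda>t. sgn (u t, v t)) \<longlongrightarrow> (sgn (u 0), 0)) at_top"
    by (rule Lim_transform_eventually[OF tendsto_const])
  moreover have "norm (sgn (u 0), 0 :: real) = 1"
    using u0 by (simp add: norm_Pair norm_sgn)
  ultimately show ?thesis
    unfolding tends_with_tangent_def diff_zero by blast
qed

subsection \<open>Existence of global solutions\<close>

text \<open>Both roots are at least 1, so their sum is at least 2; this absorbs the factor 2 in the
  difference of their squares.\<close>

lemma sqrt_max_1_lipschitz: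
  fixes x y :: real
  shows "\<bar>sqrt (max (2 * x) 1) - sqrt (max (2 * y) 1)\<bar> \<le> \<bar>x - y\<bar>"
proof -
  define p q where "p = sqrt (max (2 * x) 1)" and "q = sqrt (max (2 * y) 1)"
  have pq: "p \<ge> 1" "q \<ge> 1" "p\<^sup>2 = max (2 * x) 1" "q\<^sup>2 = max (2 * y) 1"
    by (auto simp: p_def q_def)
  have "2 * \<bar>p - q\<bar> \<le> (p + q) * \<bar>p - q\<bar>"
    using pq by (intro mult_right_mono) auto
  also have "\<dots> = \<bar>(p + q) * (p - q)\<bar>"
    using pq by (simp add: abs_mult)
  also have "\<dots> = \<bar>p\<^sup>2 - q\<^sup>2\<bar>"
    by (simp add: power2_eq_square algebra_simps)
  also have "\<dots> \<le> 2 * \<bar>x - y\<bar>"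
    unfolding pq by (auto simp: max_def abs_if)
  finally show ?thesis
    by (simp add: p_def q_def)
qed

text \<open>
  With \<open>x = x0 + t\<close> and \<open>w = y\<^sup>2 / 2\<close>, the orbit equation \<open>y * y' = d / 2 * y - A * x - c * x\<^sup>2\<close>
  of the affine system becomes the one below. Truncating the square root makes it globally
  Lipschitz in \<open>w\<close>, and the barrier shows that the truncation is never active.
\<close>

lemma affine_energy_solution:
  fixes d A c x0 y0 N X :: real
  assumes c: "c < 0" and y0: "y0 > 0" and X: "X \<ge> 0"
    and N: "N > \<bar>d\<bar> / 2 + A\<^sup>2 / (- 4 * c)"
    and rising: "\<And>x. x \<ge> X \<Longrightarrow> 0 < d / 2 - A * x - c * x\<^sup>2"
    and large: "1 + N * max 0 (X - x0) < y0"
  obtains w where "w 0 = y0\<^sup>2 / 2"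
    and "\<And>t. t \<ge> 0 \<Longrightarrow> w t > 1 / 2"
    and "\<And>t. t \<ge> 0 \<Longrightarrow>
      (w has_real_derivative d / 2 * sqrt (2 * w t) - A * (x0 + t) - c * (x0 + t)\<^sup>2) (at t within {0..})"
proof -
  define f where "f = (\<lambda>t w. d / 2 * sqrt (max (2 * w) 1) - A * (x0 + t) - c * (x0 + t)\<^sup>2)"
  \<comment> \<open>Collects the bounds
    \<open>(x0 + t)\<^sup>2 \<le> 2 * x0\<^sup>2 + 2 * t\<^sup>2\<close> and
    \<open>t\<^sup>2 \<le> 2 * E\<close>. The exponent \<open>\<bar>d\<bar> / 2 + 1\<close> strictly
    exceeds the Lipschitz constant \<open>\<bar>d\<bar> / 2\<close>.\<close>
  define C where "C = \<bar>d\<bar> / 2 + \<bar>A\<bar> * (\<bar>x0\<bar> + 1) - c * (2 * x0\<^sup>2 + 4)"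
  have growth: "norm (f t 0) \<le> C * exp ((\<bar>d\<bar> / 2 + 1) * t)" if t: "t \<ge> 0" for t
  proof -
    define E where "E = exp ((\<bar>d\<bar> / 2 + 1) * t)"
    have "exp t \<le> E"
      unfolding E_def using t by (simp add: algebra_simps)
    moreover have "1 + t + t\<^sup>2 / 2 \<le> exp t"
      using exp_lower_Taylor_quadratic[OF t] .
    ultimately have E: "1 \<le> E" "t \<le> E" "t\<^sup>2 \<le> 2 * E"
      using t zero_le_power2[of t] by linarith+
    have "\<bar>x0\<bar> \<le> \<bar>x0\<bar> * E" "x0\<^sup>2 \<le> x0\<^sup>2 * E" "\<bar>d\<bar> / 2 \<le> \<bar>d\<bar> / 2 * E"
      using E(1) by (auto simp: mult_le_cancel_left1)
    have "(x0 + t)\<^sup>2 \<le> 2 * x0\<^sup>2 + 2 * t\<^sup>2"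
      using sum_squares_bound[of x0 t] by (simp add: power2_sum)
    also have "\<dots> \<le> (2 * x0\<^sup>2 + 4) * E"
      using E \<open>x0\<^sup>2 \<le> x0\<^sup>2 * E\<close> by (simp add: distrib_right)
    finally have q: "- c * (x0 + t)\<^sup>2 \<le> - c * ((2 * x0\<^sup>2 + 4) * E)"
      using c by (intro mult_left_mono) auto
    have "\<bar>A * (x0 + t)\<bar> \<le> \<bar>A\<bar> * ((\<bar>x0\<bar> + 1) * E)"
      unfolding abs_mult using E t \<open>\<bar>x0\<bar> \<le> \<bar>x0\<bar> * E\<close> by (intro mult_left_mono) (auto simp: distrib_right)
    moreover have "\<bar>c * (x0 + t)\<^sup>2\<bar> = - c * (x0 + t)\<^sup>2"
      using c by (simp add: abs_mult)
    moreover have "C * E = \<bar>d\<bar> / 2 * E + \<bar>A\<bar> * ((\<bar>x0\<bar> + 1) * E) + - c * ((2 * x0\<^sup>2 + 4) * E)"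
      by (simp add: C_def algebra_simps)
    moreover have "\<bar>f t 0\<bar> \<le> \<bar>d\<bar> / 2 + \<bar>A * (x0 + t)\<bar> + \<bar>c * (x0 + t)\<^sup>2\<bar>"
      by (simp add: f_def)
    ultimately show ?thesis
      using q \<open>\<bar>d\<bar> / 2 \<le> \<bar>d\<bar> / 2 * E\<close> unfolding E_def[symmetric] real_norm_def by linarith
  qed
  have lip: "norm (f t x - f t y) \<le> \<bar>d\<bar> / 2 * norm (x - y)" for t x y
  proof -
    have "f t x - f t y = d / 2 * (sqrt (max (2 * x) 1) - sqrt (max (2 * y) 1))"
      by (simp add: f_def algebra_simps)
    then have "norm (f t x - f t y) = \<bar>d\<bar> / 2 * \<bar>sqrt (max (2 * x) 1) - sqrt (max (2 * y) 1)\<bar>"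
      by (simp only: real_norm_def abs_mult) simp
    then show ?thesis
      using mult_left_mono[OF sqrt_max_1_lipschitz[of x y], of "\<bar>d\<bar> / 2"] by simp
  qed
  have cont: "continuous_on ({0..} \<times> UNIV) (\<lambda>(t, x). f t x)"
    unfolding f_def case_prod_unfold by (intro continuous_intros) auto
  obtain w where w0: "w 0 = y0\<^sup>2 / 2"
    and dw: "\<And>t. t \<ge> 0 \<Longrightarrow> (w has_vector_derivative f t (w t)) (at t within {0..})"
    by (rule global_solution_exists[OF cont lip growth, of "y0\<^sup>2 / 2"]) auto
  have dw': "(w has_real_derivative f t (w t)) (at t within {a..b})" if "t \<ge> 0" "a \<ge> 0" for t a b
    unfolding has_real_derivative_iff_has_vector_derivative
    by (rule has_vector_derivative_within_subset[OF dw]) (use that in auto)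
  \<comment> \<open>From time \<open>T\<close> on, \<open>x \<ge> X\<close> and
    \<open>rising\<close> applies; before \<open>T\<close> a descending barrier is used.\<close>
  define T where "T = max 0 (X - x0)"
  have T: "T \<ge> 0" "x0 + T \<ge> X"
    by (auto simp: T_def)
  have A2: "A\<^sup>2 / (- 4 * c) \<ge> 0"
    using c by (intro divide_nonneg_pos) auto
  then have N0: "N > 0"
    using N by linarith
  \<comment> \<open>Completing the square bounds how fast the position-dependent terms can lower the
    energy.\<close>
  have quad: "- A * x - c * x\<^sup>2 \<ge> - (A\<^sup>2 / (- 4 * c))" for x
  proof -
    have "0 \<le> (2 * c * x + A)\<^sup>2 / (- 4 * c)"
      using c by (intro divide_nonneg_pos) auto
    also have "\<dots> = - A * x - c * x\<^sup>2 + A\<^sup>2 / (- 4 * c)"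
      using c by (simp add: field_simps power2_eq_square)
    finally show ?thesis by simp
  qed
  have early: "w t > 1 / 2" if t: "t \<in> {0..T}" for t
  proof -
    \<comment> \<open>The barrier \<open>y = b s\<close> descends with slope \<open>- N\<close> to
      the value 1 at \<open>T\<close>. By \<open>large\<close> it starts below \<open>y0\<close>; at
      contact the energy gap has derivative \<open>f + N * b\<close>, positive because
      \<open>N\<close> beats both loss terms and \<open>b \<ge> 1\<close>.\<close>
    define b where "b = (\<lambda>s. 1 + N * (T - s))"
    define g where "g = (\<lambda>s. w s - (b s)\<^sup>2 / 2)"
    have "g t > 0"
    proof (rule pos_if_deriv_pos_at_zeros[of 0 T g "\<lambda>s. f s (w s) + N * b s"])
      have "(1 + N * T)\<^sup>2 < y0\<^sup>2"
        using large N0 T by (intro power_strict_mono) (auto simp: T_def)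
      then show "g 0 > 0"
        by (simp add: g_def b_def w0)
    next
      fix s assume s: "s \<in> {0..T}"
      show "(g has_real_derivative f s (w s) + N * b s) (at s within {0..T})"
        unfolding g_def b_def using s by (auto intro!: derivative_eq_intros dw')
      assume "g s = 0"
      moreover have b: "b s \<ge> 1"
        using s N0 by (simp add: b_def)
      moreover from this have "(b s)\<^sup>2 \<ge> 1"
        by simp
      ultimately have "max (2 * w s) 1 = (b s)\<^sup>2"
        unfolding g_def by linarith
      then have "f s (w s) = d / 2 * b s - A * (x0 + s) - c * (x0 + s)\<^sup>2"
        using b by (simp add: f_def)
      moreover have "\<bar>d\<bar> / 2 * b s \<ge> - (d / 2) * b s"
        using b by (intro mult_right_mono) auto
      moreover have "(N - \<bar>d\<bar> / 2) * b s \<ge> (N - \<bar>d\<bar> / 2) * 1"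
      proof (rule mult_left_mono[OF b])
        show "0 \<le> N - \<bar>d\<bar> / 2"
          using N A2 by linarith
      qed
      ultimately show "f s (w s) + N * b s > 0"
        using N quad[of "x0 + s"] by (simp add: algebra_simps)
    qed (use t in auto)
    moreover have "(b t)\<^sup>2 \<ge> 1"
      using t N0 by (simp add: b_def)
    ultimately show ?thesis
      by (simp add: g_def)
  qed
  have late: "w t > 1 / 2" if t: "t \<ge> T" for t
  proof -
    have "w t - 1 / 2 > 0"
    \<comment> \<open>The barrier is now the level \<open>y = 1\<close>, where the right-hand side
      is exactly the expression in \<open>rising\<close>.\<close>
    proof (rule pos_if_deriv_pos_at_zeros[of T t "\<lambda>s. w s - 1 / 2" "\<lambda>s. f s (w s)"])
      fix s assume s: "s \<in> {T..t}"
      show "((\<lambda>s. w s - 1 / 2) has_real_derivative f s (w s)) (at s within {T..t})"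
        using s T by (auto intro!: derivative_eq_intros dw')
      assume "w s - 1 / 2 = 0"
      then have half: "w s = 1 / 2"
        by simp
      show "f s (w s) > 0"
        unfolding half using rising[of "x0 + s"] s T by (simp add: f_def)
    qed (use t T early[of T] in auto)
    then show ?thesis by simp
  qed
  have w: "w t > 1 / 2" if "t \<ge> 0" for t
    using early[of t] late[of t] that by force
  show ?thesis
  proof (rule that[of w, OF w0 w])
    fix t :: real assume t: "t \<ge> 0"
    then have "max (2 * w t) 1 = 2 * w t"
      using w[OF t] by simp
    then show "(w has_real_derivative d / 2 * sqrt (2 * w t) - A * (x0 + t) - c * (x0 + t)\<^sup>2) (at t within {0..})"
      using dw[OF t] by (simp add: f_def has_real_derivative_iff_has_vector_derivative)
  qed
qed

text \<open>Returns from the energy to the chart: with \<open>y = sqrt (2 * w)\<close> one has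
  \<open>y * y' = w'\<close>, and the rate at \<open>(x / y, 1 / y)\<close> equals
  \<open>- y' / y\<close>.\<close>

lemma chart_field_solution_of_energy:
  fixes w :: "real \<Rightarrow> real"
  assumes pos: "\<And>t. t \<ge> 0 \<Longrightarrow> w t > 0"
    and deriv: "\<And>t. t \<ge> 0 \<Longrightarrow>
      (w has_real_derivative d / 2 * sqrt (2 * w t) - A * (x0 + t) - c * (x0 + t)\<^sup>2) (at t within {0..})"
  shows "ode_solution (chart_field d A c) {0..}
    (\<lambda>t. ((x0 + t) / sqrt (2 * w t), 1 / sqrt (2 * w t)))"
  unfolding ode_solution_chart_field_iff
proof
  fix t :: real assume "t \<in> {0..}"
  then have t: "t \<ge> 0" by simp
  define y where "y = (\<lambda>t. sqrt (2 * w t))"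
  define x where "x = x0 + t"
  have y: "y t > 0" "(y t)\<^sup>2 = 2 * w t"
    using pos[OF t] by (auto simp: y_def)
  define y' where "y' = (d / 2 * y t - A * x - c * x\<^sup>2) / y t"
  have dy: "(y has_real_derivative y') (at t within {0..})"
    unfolding y_def y'_def x_def using pos[OF t]
    by (auto intro!: derivative_eq_intros deriv t simp: field_simps)
  have rate: "radial_rate d A c (x / y t) (1 / y t) = - y' / y t"
    using y(1) by (simp add: radial_rate_def y'_def field_simps power2_eq_square)
  have "((\<lambda>t. 1 / y t) has_real_derivative - y' / y t * (1 / y t)) (at t within {0..})"
    using y(1) by (auto intro!: derivative_eq_intros dy simp: power2_eq_square)
  moreover have "((\<lambda>t. (x0 + t) / y t) has_real_derivative 1 / y t + x / y t * (- y' / y t)) (at t within {0..})"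
    using y(1) by (auto intro!: derivative_eq_intros dy simp: x_def field_simps power2_eq_square)
  ultimately show "((\<lambda>t. (x0 + t) / sqrt (2 * w t)) has_real_derivative
        1 / sqrt (2 * w t) + (x0 + t) / sqrt (2 * w t) *
          radial_rate d A c ((x0 + t) / sqrt (2 * w t)) (1 / sqrt (2 * w t))) (at t within {0..}) \<and>
      ((\<lambda>t. 1 / sqrt (2 * w t)) has_real_derivative
        radial_rate d A c ((x0 + t) / sqrt (2 * w t)) (1 / sqrt (2 * w t)) * (1 / sqrt (2 * w t)))
          (at t within {0..})"
    using rate unfolding x_def y_def by simp
qed

text \<open>Near the origin \<open>y0 = 1 / v0\<close> is large. Although
  \<open>x0 = u0 / v0\<close> may be very negative, \<open>\<bar>x0\<bar> < \<delta> * y0\<close>,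
  so the descent up to \<open>X\<close> uses only part of the initial height.\<close>

lemma chart_field_solution_exists_upper:
  fixes d A c :: real
  assumes c: "c < 0"
  obtains \<delta> where "\<delta> > 0"
    and "\<And>u0 v0. v0 > 0 \<Longrightarrow> norm (u0, v0) < \<delta> \<Longrightarrow>
      \<exists>\<phi>. ode_solution (chart_field d A c) {0..} \<phi> \<and> \<phi> 0 = (u0, v0)"
proof -
  define N where "N = \<bar>d\<bar> / 2 + A\<^sup>2 / (- 4 * c) + 1"
  have "A\<^sup>2 / (- 4 * c) \<ge> 0"
    using c by (intro divide_nonneg_pos) auto
  then have N: "N > 0"
    unfolding N_def by linarith
  \<comment> \<open>Beyond \<open>X\<close> the factor \<open>- A - c * x\<close> is at least
    \<open>\<bar>d\<bar> / 2 + 1\<close>, and \<open>x \<ge> 1\<close> preserves this bound for the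
    product.\<close>
  define X where "X = max 1 ((\<bar>A\<bar> + \<bar>d\<bar> / 2 + 1) / (- c))"
  have X: "X \<ge> 1" "(\<bar>A\<bar> + \<bar>d\<bar> / 2 + 1) / (- c) \<le> X"
    by (auto simp: X_def)
  then have cX: "\<bar>A\<bar> + \<bar>d\<bar> / 2 + 1 \<le> - c * X"
    using c by (simp add: field_simps)
  have rising: "0 < d / 2 - A * x - c * x\<^sup>2" if x: "x \<ge> X" for x
  proof -
    have "- c * X \<le> - c * x"
      using c x by (intro mult_left_mono) auto
    then have "\<bar>d\<bar> / 2 + 1 \<le> - A - c * x"
      using cX by linarith
    then have "1 * (\<bar>d\<bar> / 2 + 1) \<le> x * (- A - c * x)"
      using x X by (intro mult_mono) auto
    then show ?thesis
      by (simp add: power2_eq_square algebra_simps)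
  qed
  \<comment> \<open>Each entry keeps one of the two contributions, \<open>1 + N * X\<close> and
    \<open>N * \<delta> / v0\<close>, within half of \<open>1 / v0\<close>.\<close>
  define \<delta> where "\<delta> = min (1 / (2 * N)) (1 / (2 * (1 + N * X)))"
  have NX: "N * X > 0" using N X by simp
  have \<delta>: "\<delta> > 0" "N * \<delta> \<le> 1 / 2" "(1 + N * X) * \<delta> \<le> 1 / 2"
  proof -
    show "\<delta> > 0" using N NX by (simp add: \<delta>_def)
    have "\<delta> \<le> 1 / (2 * N)" "\<delta> \<le> 1 / (2 * (1 + N * X))" by (simp_all add: \<delta>_def)
    then show "N * \<delta> \<le> 1 / 2" "(1 + N * X) * \<delta> \<le> 1 / 2"
      using N NX by (simp_all add: field_simps)
  qed
  show ?thesis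
  proof (rule that[OF \<delta>(1)])
    fix u0 v0 :: real assume v0: "v0 > 0" and small: "norm (u0, v0) < \<delta>"
    have uv: "\<bar>u0\<bar> < \<delta>" "v0 < \<delta>"
      using norm_fst_le[of u0 v0] norm_snd_le[of v0 u0] small by auto
    have T: "max 0 (X - u0 / v0) \<le> X + \<delta> / v0"
    proof -
      have "- (u0 / v0) \<le> \<delta> / v0"
        using uv v0 by (simp add: field_simps)
      moreover have "0 \<le> \<delta> / v0"
        using \<delta>(1) v0 by simp
      ultimately show ?thesis using X by auto
    qed
    have "1 + N * max 0 (X - u0 / v0) \<le> (1 + N * X) + N * \<delta> / v0"
      using mult_left_mono[OF T, of N] N by (simp add: algebra_simps)
    also have "(1 + N * X) < (1 / 2) / v0"
    proof -
      have "(1 + N * X) * v0 < (1 + N * X) * \<delta>"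
        using uv NX by (intro mult_strict_left_mono) auto
      then show ?thesis
        using \<delta>(3) v0 by (simp add: field_simps)
    qed
    also have "N * \<delta> / v0 \<le> (1 / 2) / v0"
      using \<delta>(2) v0 by (intro divide_right_mono) auto
    finally have "1 + N * max 0 (X - u0 / v0) < 1 / v0"
      by simp
    then obtain w where w: "w 0 = (1 / v0)\<^sup>2 / 2" "\<And>t. t \<ge> 0 \<Longrightarrow> w t > 1 / 2"
      "\<And>t. t \<ge> 0 \<Longrightarrow> (w has_real_derivative
        d / 2 * sqrt (2 * w t) - A * (u0 / v0 + t) - c * (u0 / v0 + t)\<^sup>2) (at t within {0..})"
      using affine_energy_solution[of c "1 / v0" X d A N "u0 / v0"] c v0 X rising
      by (auto simp: N_def)
    have "ode_solution (chart_field d A c) {0..}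
        (\<lambda>t. ((u0 / v0 + t) / sqrt (2 * w t), 1 / sqrt (2 * w t)))"
      by (rule chart_field_solution_of_energy) (use w(2,3) in \<open>auto intro: less_trans[of 0 "1 / 2"]\<close>)
    moreover have "sqrt (2 * w 0) = 1 / v0"
      using v0 unfolding w(1) by (intro real_sqrt_unique) auto
    ultimately show "\<exists>\<phi>. ode_solution (chart_field d A c) {0..} \<phi> \<and> \<phi> 0 = (u0, v0)"
      using v0 by (intro exI[of _ "\<lambda>t. ((u0 / v0 + t) / sqrt (2 * w t), 1 / sqrt (2 * w t))"]) simp
  qed
qed

text \<open>On \<open>v = 0\<close> the equation \<open>u' = c * u ^ 3\<close> has the solution
  \<open>u0 / sqrt (1 - 2 * c * u0\<^sup>2 * t)\<close>; for \<open>c < 0\<close> the radicand stays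
  positive for all \<open>t \<ge> 0\<close>.\<close>

lemma chart_field_solution_exists_at_infinity:
  fixes d A c u0 :: real
  assumes c: "c < 0"
  shows "\<exists>\<phi>. ode_solution (chart_field d A c) {0..} \<phi> \<and> \<phi> 0 = (u0, 0)"
proof -
  define q where "q = (\<lambda>t. 1 - 2 * c * u0\<^sup>2 * t)"
  define u where "u = (\<lambda>t. u0 / sqrt (q t))"
  have "(u has_real_derivative u t * (c * (u t)\<^sup>2)) (at t within {0..})" if t: "t \<ge> 0" for t
  proof -
    have "c * u0\<^sup>2 * t \<le> 0"
      using c t by (simp add: mult_nonpos_nonneg)
    then have q: "q t > 0"
      by (auto simp: q_def)
    have dq: "(q has_real_derivative - (2 * c * u0\<^sup>2)) (at t within {0..})"
      unfolding q_def by (auto intro!: derivative_eq_intros)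
    define r where "r = (\<lambda>t. sqrt (q t))"
    have r: "r t > 0"
      using q by (simp add: r_def)
    have dr: "(r has_real_derivative - (c * u0\<^sup>2) / r t) (at t within {0..})"
      unfolding r_def using q by (auto intro!: derivative_eq_intros dq simp: field_simps)
    have "((\<lambda>t. u0 / r t) has_real_derivative u0 / r t * (c * (u0 / r t)\<^sup>2)) (at t within {0..})"
      using r by (auto intro!: derivative_eq_intros dr simp: field_simps power2_eq_square)
    then show ?thesis
      by (simp add: u_def r_def)
  qed
  then have "ode_solution (chart_field d A c) {0..} (\<lambda>t. (u t, 0))"
    by (simp add: ode_solution_chart_field_iff radial_rate_def)
  moreover have "u 0 = u0"
    by (simp add: u_def q_def)
  ultimately show ?thesis
    by (intro exI[of _ "\<lambda>t. (u t, 0)"]) simp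
qed

subsection \<open>Nodes of the chart field\<close>

lemma isolated_critical_point_chart_field:
  assumes "c \<noteq> 0"
  shows "isolated_critical_point (chart_field d A c) 0"
  by (auto simp: isolated_critical_point_def chart_field_eq_0_iff[OF assms] eventually_at_filter)

lemma ode_solution_chart_field_uminus:
  assumes "ode_solution (chart_field d A c) I \<phi>"
  shows "ode_solution (chart_field (- d) A c) I (\<lambda>t. - \<phi> t)"
  by (rule ode_solution_linear_image[OF bounded_linear_minus[OF bounded_linear_ident] _ assms])
     (rule chart_field_uminus)

lemma chart_field_tends:
  assumes sol: "ode_solution (chart_field d A c) {0..} \<phi>" and c: "c < 0" and nz: "\<phi> 0 \<noteq> 0"
  shows "tends_with_tangent \<phi> 0 at_top"
proof -
  define u v where "u = (\<lambda>t. fst (\<phi> t))" and "v = (\<lambda>t. snd (\<phi> t))"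
  have \<phi>: "\<phi> = (\<lambda>t. (u t, v t))"
    by (simp add: u_def v_def)
  note sol = sol[unfolded \<phi>]
  consider "v 0 > 0" | "v 0 = 0" "u 0 \<noteq> 0" | "v 0 < 0"
    using nz unfolding \<phi> zero_prod_def prod.inject by linarith
  then show ?thesis
  proof cases
    case 1
    then show ?thesis
      using chart_field_tends_upper[OF sol _ c] by (simp add: \<phi>)
  next
    case 2
    then show ?thesis
      using chart_field_tends_at_infinity[OF sol _ _ c] by (simp add: \<phi>)
  next
    case 3
    have "ode_solution (chart_field (- d) A c) {0..} (\<lambda>t. (- u t, - v t))"
      using ode_solution_chart_field_uminus[OF sol] by simp
    then have "tends_with_tangent (\<lambda>t. (- u t, - v t)) 0 at_top"
      by (rule chart_field_tends_upper) (use 3 c in auto)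
    from tends_with_tangent_isometry[OF bounded_linear_minus[OF bounded_linear_ident] norm_minus_cancel this]
    show ?thesis
      by (simp add: \<phi>)
  qed
qed

lemma chart_field_solution_exists:
  fixes d A c :: real
  assumes c: "c < 0"
  obtains \<delta> where "\<delta> > 0"
    and "\<And>z. norm z < \<delta> \<Longrightarrow> \<exists>\<phi>. ode_solution (chart_field d A c) {0..} \<phi> \<and> \<phi> 0 = z"
proof -
  obtain \<delta>1 where \<delta>1: "\<delta>1 > 0" "\<And>u0 v0. v0 > 0 \<Longrightarrow> norm (u0, v0) < \<delta>1 \<Longrightarrow>
      \<exists>\<phi>. ode_solution (chart_field d A c) {0..} \<phi> \<and> \<phi> 0 = (u0, v0)"
    using chart_field_solution_exists_upper[OF c] by metis
  \<comment> \<open>Points with \<open>v0 < 0\<close> are negated into the upper half-plane, where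
    the parameter becomes \<open>- d\<close>; this needs its own radius.\<close>
  obtain \<delta>2 where \<delta>2: "\<delta>2 > 0" "\<And>u0 v0. v0 > 0 \<Longrightarrow> norm (u0, v0) < \<delta>2 \<Longrightarrow>
      \<exists>\<phi>. ode_solution (chart_field (- d) A c) {0..} \<phi> \<and> \<phi> 0 = (u0, v0)"
    using chart_field_solution_exists_upper[OF c] by metis
  show ?thesis
  proof (rule that[of "min \<delta>1 \<delta>2"])
    show "min \<delta>1 \<delta>2 > 0" using \<delta>1 \<delta>2 by simp
    fix z :: "real \<times> real" assume small: "norm z < min \<delta>1 \<delta>2"
    obtain u0 v0 where z: "z = (u0, v0)" by (cases z)
    consider "v0 > 0" | "v0 = 0" | "v0 < 0" by linarith
    then show "\<exists>\<phi>. ode_solution (chart_field d A c) {0..} \<phi> \<and> \<phi> 0 = z"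
    proof cases
      case 1
      then show ?thesis using \<delta>1(2) small z by simp
    next
      case 2
      then show ?thesis using chart_field_solution_exists_at_infinity[OF c] z by simp
    next
      case 3
      have "norm (- u0, - v0) < \<delta>2"
        using small norm_minus_cancel[of z] by (simp add: z)
      then obtain \<phi> where "ode_solution (chart_field (- d) A c) {0..} \<phi>" "\<phi> 0 = (- u0, - v0)"
        using \<delta>2(2)[of "- v0" "- u0"] 3 by auto
      then show ?thesis
        using ode_solution_chart_field_uminus[of "- d" A c "{0..}" \<phi>]
        by (intro exI[of _ "\<lambda>t. - \<phi> t"]) (simp add: z)
    qed
  qed
qed

lemma stable_node_chart_field:
  assumes c: "c < 0"
  shows "stable_node (chart_field d A c) 0"
proof -
  obtain \<delta> where "\<delta> > 0"
    "\<And>z. norm z < \<delta> \<Longrightarrow> \<exists>\<phi>. ode_solution (chart_field d A c) {0..} \<phi> \<and> \<phi> 0 = z"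
    using chart_field_solution_exists[OF c] by metis
  then show ?thesis
    using isolated_critical_point_chart_field[of c d A] chart_field_tends[OF _ c] c
    unfolding stable_node_def by (auto intro!: exI[of _ \<delta>])
qed

lemma unstable_node_chart_field:
  assumes c: "c > 0"
  shows "unstable_node (chart_field d A c) 0"
proof (rule unstable_node_of_stable_node[where R = "\<lambda>z. (fst z, - snd z)" and G = "chart_field d A (- c)"])
  show "stable_node (chart_field d A (- c)) 0"
    using c by (intro stable_node_chart_field) simp
  show "bounded_linear (\<lambda>z :: real \<times> real. (fst z, - snd z))"
    by (intro bounded_linear_Pair bounded_linear_minus bounded_linear_fst bounded_linear_snd)
qed (auto simp: norm_prod_def chart_field_reflect)

section \<open>Degree of the planar field and its chart expression\<close>

lemma bivariate_poly_le_linear_quadratic: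
  fixes r q s :: real
  shows "bivariate_poly_le 2 (\<lambda>x y. r * y + q * x + s * x\<^sup>2)"
  unfolding bivariate_poly_le_def
  by (rule exI[of _ "\<lambda>i j. if i = 0 \<and> j = 1 then r else if i = 1 \<and> j = 0 then q
        else if i = 2 \<and> j = 0 then s else 0"])
     (simp add: numeral_2_eq_2 power2_eq_square)

text \<open>The second difference in \<open>x\<close> at the points -1, 0, 1 with
  \<open>y = 0\<close> is \<open>2 * s\<close>, whereas it vanishes for polynomials of degree at
  most 1.\<close>

lemma not_bivariate_poly_le_quadratic:
  fixes r q s :: real
  assumes "s \<noteq> 0" "m < 2"
  shows "\<not> bivariate_poly_le m (\<lambda>x y. r * y + q * x + s * x\<^sup>2)"
proof
  assume "bivariate_poly_le m (\<lambda>x y. r * y + q * x + s * x\<^sup>2)"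
  then obtain k where k: "\<And>x y. r * y + q * x + s * x\<^sup>2 = (\<Sum>i\<le>m. \<Sum>j\<le>m - i. k i j * x ^ i * y ^ j)"
    unfolding bivariate_poly_le_def by blast
  consider "m = 0" | "m = 1" using assms(2) by linarith
  then show False
  proof cases
    case 1
    have "q + s = k 0 0" "- q + s = k 0 0" "0 = k 0 0"
      using k[where x = 1 and y = 0] k[where x = "- 1" and y = 0] k[where x = 0 and y = 0] 1 by simp_all
    then show ?thesis using assms(1) by linarith
  next
    case 2
    have "q + s = k 0 0 + k 1 0"
      using k[where x = 1 and y = 0] 2 by simp
    moreover have "- q + s = k 0 0 - k 1 0"
      using k[where x = "- 1" and y = 0] 2 by simp
    moreover have "0 = k 0 0"
      using k[where x = 0 and y = 0] 2 by simp
    ultimately show ?thesis using assms(1) by linarith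
  qed
qed

theorem proposition6p4:
  fixes a c d :: real and p :: nat
    and P Q :: "real \<Rightarrow> real \<Rightarrow> real"
    and F :: "real \<times> real \<Rightarrow> real \<times> real"
  assumes "a \<noteq> 0" and "c \<noteq> 0"
    and "d = a * (real p + 4)"
    and "P = (\<lambda>x y. y)"
    and "Q = (\<lambda>x y. d / 2 * y - 3 / 2 * a^2 * x - c * x^2)"
    and "F = (\<lambda>(u, v). (v - d * u * v / 2 + 3 / 2 * a^2 * u^2 * v + c * u^3,
                        - (d * v^2 / 2) + 3 / 2 * a^2 * u * v^2 + c * u^2 * v))"
  shows "chart_U2_field P Q F \<and>
         (c < 0 \<longrightarrow> stable_node F (0, 0)) \<and>
         (c > 0 \<longrightarrow> unstable_node F (0, 0))"
proof -
  have F: "F = chart_field d (3 / 2 * a\<^sup>2) c"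
    unfolding assms(6) chart_field_def radial_rate_def
    by (auto simp: fun_eq_iff algebra_simps power2_eq_square power3_eq_cube)
  have P: "P = (\<lambda>x y. 1 * y + 0 * x + 0 * x\<^sup>2)"
    by (simp add: assms(4))
  have Q: "Q = (\<lambda>x y. d / 2 * y + - (3 / 2 * a\<^sup>2) * x + - c * x\<^sup>2)"
    by (simp add: assms(5))
  \<comment> \<open>\<open>P\<close> has degree 1, so minimality of the degree 2 rests on the
    quadratic term of \<open>Q\<close> and on \<open>c \<noteq> 0\<close>.\<close>
  have "\<not> bivariate_poly_le m Q" if "m < 2" for m
    unfolding Q using that assms(2) by (intro not_bivariate_poly_le_quadratic) auto
  moreover have "bivariate_poly_le 2 P" "bivariate_poly_le 2 Q"
    unfolding P Q by (rule bivariate_poly_le_linear_quadratic)+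
  ultimately have "polynomial_field 2 P Q"
    unfolding polynomial_field_def by blast
  moreover have "continuous_on UNIV F"
    unfolding assms(6) case_prod_unfold by (intro continuous_intros) auto
  moreover have "F (u, v) = (v ^ 2 * (P (u / v) (1 / v) - u * Q (u / v) (1 / v)),
      - (v ^ (2 + 1)) * Q (u / v) (1 / v))" if "v \<noteq> 0" for u v
    using that by (simp add: assms(4-6) field_simps power2_eq_square power3_eq_cube)
  ultimately have "chart_U2_field P Q F"
    unfolding chart_U2_field_def by blast
  then show ?thesis
    using stable_node_chart_field[of c] unstable_node_chart_field[of c]
    by (simp add: F zero_prod_def[symmetric])
qed

end
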